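(* Let $N$ be a positive integer, $a\in\mathbb{R}$, $b\in[0,1]$. For all $k,l,k',l'\in\{0,\dots,N-1\}$ with $k\ge l$ and $k'\ge l'$, $$\sum_{\substack{m,n=0\\ m\ge n}}^{N-1}G_{mn}^{-1}\,E^+_{(k,l)}(x_m,y_n)\,\overline{E^+_{(k',l')}(x_m,y_n)}=G_{kl}\,N^2\,\delta_{kk'}\delta_{ll'}.$$ Moreover, if $N=2M+1$ is odd, the same relation also holds for all $k,l,k',l'\in\{-M,\dots,M\}$ with $k\ge l$ and $k'\ge l'$.
   Context: For $k,l\in\mathbb{Z}$ and $x,y\in\mathbb{R}$, the symmetric exponential function is $E^+_{(k,l)}(x,y)=e^{2\pi i(kx+ly)}+e^{2\pi i(ky+lx)}$. The grid points are $(x_m,y_n)=\left(a+\frac{m+b}{N},\,a+\frac{n+b}{N}\right)$ for $m,n\in\{0,\dots,N-1\}$. $G_{kl}=2$ if $k=l$ and $G_{kl}=1$ otherwise. $\delta$ is the Kronecker delta. *)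

theory Defs
  imports "HOL-Analysis.Analysis"
begin

definition sym_exp :: "int \<Rightarrow> int \<Rightarrow> real \<Rightarrow> real \<Rightarrow> complex" where
  "sym_exp k l x y =
     exp (2 * complex_of_real pi * \<i> * complex_of_real (of_int k * x + of_int l * y))
   + exp (2 * complex_of_real pi * \<i> * complex_of_real (of_int k * y + of_int l * x))"

(* Both coordinates of the grid are given by the same formula: x_m = grid_coord N a b m
   and y_n = grid_coord N a b n. *)
definition grid_coord :: "nat \<Rightarrow> real \<Rightarrow> real \<Rightarrow> nat \<Rightarrow> real" where
  "grid_coord N a b m = a + (real m + b) / real N"

(* Polymorphic, since G is used both for grid indices (nat) and for frequencies (int). *)
definition G_weight :: "'a \<Rightarrow> 'a \<Rightarrow> complex" where
  "G_weight k l = (if k = l then 2 else 1)"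

definition kronecker_delta :: "'a \<Rightarrow> 'a \<Rightarrow> complex" where
  "kronecker_delta k l = (if k = l then 1 else 0)"

end

theory Submission
  imports Defs
begin

text \<open>The summand is symmetric in \<open>m\<close> and \<open>n\<close>, so the weighted sum over the triangle is half the
  sum over the whole square. There the sum factors into one-dimensional geometric sums, which
  vanish unless the two frequencies agree, because all frequencies differ by less than \<open>N\<close>.
  This gives \<open>\<delta>\<^sub>k\<^sub>k\<^sub>' \<delta>\<^sub>l\<^sub>l\<^sub>' + \<delta>\<^sub>k\<^sub>l\<^sub>' \<delta>\<^sub>l\<^sub>k\<^sub>'\<close>, and the ordering of the indices allows the second
  product to be nonzero only if all four agree.\<close>

definition fourier_exp :: "int \<Rightarrow> real \<Rightarrow> complex" where
  "fourier_exp k x = exp (2 * complex_of_real pi * \<i> * complex_of_real (of_int k * x))"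

lemma sym_exp_eq_fourier_exp:
  "sym_exp k l x y = fourier_exp k x * fourier_exp l y + fourier_exp k y * fourier_exp l x"
  by (simp add: sym_exp_def fourier_exp_def distrib_left flip: exp_add)

lemma sym_exp_commute: "sym_exp k l y x = sym_exp k l x y"
  by (simp add: sym_exp_def add.commute)

lemma fourier_exp_mult_cnj:
  "fourier_exp k x * cnj (fourier_exp k' x) = fourier_exp (k - k') x"
  by (simp add: fourier_exp_def exp_cnj algebra_simps flip: exp_add)

lemma fourier_exp_add: "fourier_exp k (x + y) = fourier_exp k x * fourier_exp k y"
  by (simp add: fourier_exp_def algebra_simps flip: exp_add)

lemma fourier_exp_power: "fourier_exp k x ^ n = fourier_exp k (real n * x)"
  by (simp add: fourier_exp_def mult_ac flip: exp_of_nat_mult)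

lemma fourier_exp_of_int: "fourier_exp k (of_int j) = 1"
  unfolding fourier_exp_def exp_eq_1 by (auto intro!: exI[of _ "k * j"])

lemma fourier_exp_eq_1_iff: "fourier_exp k x = 1 \<longleftrightarrow> (\<exists>j. of_int k * x = of_int j)"
  by (auto simp: fourier_exp_def exp_eq_1)

text \<open>The grid is an arithmetic progression of step \<open>1 / N\<close>, so the terms form a
  geometric progression whose ratio \<open>w\<close> is an N-th root of unity. For nonzero k,
  \<open>w = 1\<close> would make N divide k, against |k| < N. The offset \<open>a + b / N\<close>
  only contributes a constant factor.\<close>

lemma sum_fourier_exp_grid:
  assumes "N > 0" and "\<bar>k\<bar> < int N"
  shows "(\<Sum>m<N. fourier_exp k (grid_coord N a b m)) = (if k = 0 then of_nat N else 0)"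
proof (cases "k = 0")
  case True
  then show ?thesis by (simp add: fourier_exp_def)
next
  case False
  define w where "w = fourier_exp k (1 / real N)"
  have "w \<noteq> 1"
  proof
    assume "w = 1"
    then obtain j where "of_int k * (1 / real N) = of_int j"
      by (auto simp: w_def fourier_exp_eq_1_iff)
    then have "real_of_int k = of_int (j * int N)"
      using \<open>N > 0\<close> by (simp add: field_simps)
    then have "int N dvd k"
      by (simp only: of_int_eq_iff dvd_triv_right)
    then show False
      using False assms(2) zdvd_imp_le[of "int N" "\<bar>k\<bar>"] by simp
  qed
  moreover have "w ^ N = 1"
    using fourier_exp_of_int[of k 1] \<open>N > 0\<close> by (simp add: w_def fourier_exp_power)
  ultimately have "(\<Sum>m<N. w ^ m) = 0"
    by (simp add: geometric_sum)
  moreover have "fourier_exp k (grid_coord N a b m) = fourier_exp k (a + b / real N) * w ^ m" for m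
    by (simp add: grid_coord_def w_def fourier_exp_power add_divide_distrib algebra_simps
        flip: fourier_exp_add)
  ultimately show ?thesis
    using False by (simp flip: sum_distrib_left)
qed

lemma fourier_exp_grid_orthogonal:
  assumes "N > 0" and "\<bar>k - k'\<bar> < int N"
  shows "(\<Sum>m<N. fourier_exp k (grid_coord N a b m) * cnj (fourier_exp k' (grid_coord N a b m)))
    = of_nat N * kronecker_delta k k'"
  using sum_fourier_exp_grid[OF assms, of a b]
  by (simp add: fourier_exp_mult_cnj kronecker_delta_def)

text \<open>Two copies of the triangle, one reflected in the diagonal, cover the square. Only the
  diagonal is covered twice, and the weight 1/2 there compensates for this.\<close>

lemma sum_triangle_symmetric:
  fixes F :: "nat \<Rightarrow> nat \<Rightarrow> complex"
  assumes sym: "\<And>m n. F m n = F n m"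
  shows "2 * (\<Sum>(m, n)\<in>{(m, n). m < N \<and> n < N \<and> m \<ge> n}. inverse (G_weight m n) * F m n)
    = (\<Sum>m<N. \<Sum>n<N. F m n)"
proof -
  define T where "T = {(m, n). m < N \<and> n < N \<and> m \<ge> n}"
  define H where "H = (\<lambda>m n. inverse (G_weight m n) * F m n)"
  have T: "T = ({..<N} \<times> {..<N}) \<inter> {p. snd p \<le> fst p}"
    by (auto simp: T_def)
  have lower: "(\<Sum>(m, n)\<in>T. H m n) = (\<Sum>m<N. \<Sum>n<N. if n \<le> m then H m n else 0)"
    by (simp add: T sum.inter_restrict sum.cartesian_product case_prod_unfold)
  \<comment> \<open>Swapping the sums and renaming the bound variables reflects the
    triangle.\<close>
  also have "\<dots> = (\<Sum>n<N. \<Sum>m<N. if n \<le> m then H m n else 0)"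
    by (rule sum.swap)
  finally have upper: "(\<Sum>(m, n)\<in>T. H m n) = (\<Sum>m<N. \<Sum>n<N. if m \<le> n then H n m else 0)" .
  \<comment> \<open>Off the diagonal exactly one summand survives, with weight 1; on it both do,
    each giving half of \<open>F m m\<close>.\<close>
  have "(if n \<le> m then H m n else 0) + (if m \<le> n then H n m else 0) = F m n" for m n
    using sym[of m n] by (cases m n rule: linorder_cases) (simp_all add: H_def G_weight_def)
  then have "(\<Sum>(m, n)\<in>T. H m n) + (\<Sum>(m, n)\<in>T. H m n) = (\<Sum>m<N. \<Sum>n<N. F m n)"
    by (subst lower, subst upper) (simp flip: sum.distrib)
  then show ?thesis
    by (simp add: T_def H_def)
qed

text \<open>Bounding only differences of frequencies covers both index ranges at once: two elements
  of {0..N-1}, or of {-M..M} with N = 2M + 1, differ by at most N - 1.\<close>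

lemma sym_exp_grid_orthogonal:
  assumes "N > 0"
    and "\<bar>k - k'\<bar> < int N" "\<bar>k - l'\<bar> < int N" "\<bar>l - k'\<bar> < int N" "\<bar>l - l'\<bar> < int N"
    and "l \<le> k" "l' \<le> k'"
  shows "(\<Sum>(m, n)\<in>{(m, n). m < N \<and> n < N \<and> m \<ge> n}.
      inverse (G_weight m n)
      * sym_exp k l (grid_coord N a b m) (grid_coord N a b n)
      * cnj (sym_exp k' l' (grid_coord N a b m) (grid_coord N a b n)))
    = G_weight k l * of_nat N ^ 2 * kronecker_delta k k' * kronecker_delta l l'" (is "?S = _")
proof -
  define x where "x = grid_coord N a b"
  define P where "P = (\<lambda>p q m. fourier_exp p (x m) * cnj (fourier_exp q (x m)))"
  define F where "F = (\<lambda>m n. sym_exp k l (x m) (x n) * cnj (sym_exp k' l' (x m) (x n)))"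
  have P: "(\<Sum>m<N. P p q m) = of_nat N * kronecker_delta p q" if "\<bar>p - q\<bar> < int N" for p q
    unfolding P_def x_def by (rule fourier_exp_grid_orthogonal[OF \<open>N > 0\<close> that])
  have PP: "(\<Sum>m<N. \<Sum>n<N. P p q m * P r s n)
      = of_nat N ^ 2 * (kronecker_delta p q * kronecker_delta r s)"
    if "\<bar>p - q\<bar> < int N" "\<bar>r - s\<bar> < int N" for p q r s
    using that by (simp add: P power2_eq_square flip: sum_product)
  \<comment> \<open>The outer two products pair k with k' and l with l', the inner two pair k with
    l' and l with k'. After summation each pairing thus occurs twice.\<close>
  have "F m n = P k k' m * P l l' n + P k l' m * P l k' n + P l k' m * P k l' n + P l l' m * P k k' n"
    for m n
    by (simp add: F_def P_def sym_exp_eq_fourier_exp algebra_simps)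
  then have "(\<Sum>m<N. \<Sum>n<N. F m n) =
      2 * of_nat N ^ 2 * (kronecker_delta k k' * kronecker_delta l l'
        + kronecker_delta k l' * kronecker_delta l k')"
    using assms(2-5) by (simp add: sum.distrib PP) (simp add: algebra_simps)
  moreover have "F m n = F n m" for m n
    by (simp add: F_def sym_exp_commute[of _ _ "x m"])
  ultimately have "2 * ?S = 2 * of_nat N ^ 2 * (kronecker_delta k k' * kronecker_delta l l'
        + kronecker_delta k l' * kronecker_delta l k')"
    using sum_triangle_symmetric[of F N] by (simp add: F_def x_def mult.assoc)
  \<comment> \<open>If the crossed term is nonzero, then k = l' \<le> k' = l \<le> k, so all four
    indices agree. It therefore adds a second 1 exactly when k = l, which turns the bracket into
    \<open>G_weight k l\<close>.\<close>
  then show ?thesis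
    using assms(6,7) by (auto simp: kronecker_delta_def G_weight_def)
qed

theorem mainTheorem4:
  fixes N :: nat and a b :: real
  assumes "N > 0" and "b \<in> {0..1}"
  shows "(\<forall>k\<in>{0..int N - 1}. \<forall>l\<in>{0..int N - 1}. \<forall>k'\<in>{0..int N - 1}. \<forall>l'\<in>{0..int N - 1}.
            k \<ge> l \<longrightarrow> k' \<ge> l' \<longrightarrow>
            (\<Sum>(m, n)\<in>{(m, n). m < N \<and> n < N \<and> m \<ge> n}.
                inverse (G_weight m n)
                * sym_exp k l (grid_coord N a b m) (grid_coord N a b n)
                * cnj (sym_exp k' l' (grid_coord N a b m) (grid_coord N a b n)))
            = G_weight k l * of_nat N ^ 2 * kronecker_delta k k' * kronecker_delta l l')
       \<and> (\<forall>M::nat. N = 2 * M + 1 \<longrightarrow>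
           (\<forall>k\<in>{- int M..int M}. \<forall>l\<in>{- int M..int M}.
            \<forall>k'\<in>{- int M..int M}. \<forall>l'\<in>{- int M..int M}.
            k \<ge> l \<longrightarrow> k' \<ge> l' \<longrightarrow>
            (\<Sum>(m, n)\<in>{(m, n). m < N \<and> n < N \<and> m \<ge> n}.
                inverse (G_weight m n)
                * sym_exp k l (grid_coord N a b m) (grid_coord N a b n)
                * cnj (sym_exp k' l' (grid_coord N a b m) (grid_coord N a b n)))
            = G_weight k l * of_nat N ^ 2 * kronecker_delta k k' * kronecker_delta l l'))"
  using assms(1) by (intro conjI ballI allI impI sym_exp_grid_orthogonal) auto

end
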